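(* Let $T$, $T_1$ and $T_2$ be finite trees, each rooted at its sink, where $T_1$ and $T_2$ have disjoint sets of non-sink vertices. Let $\mathscr{A}_T$, $\mathscr{A}_{T_1}$, $\mathscr{A}_{T_2}$ be their multivariate avalanche polynomials, with one variable for each non-sink vertex. Then: (1) $\mathscr{A}_{T_1+T_2} = \mathscr{A}_{T_1} + \mathscr{A}_{T_2}$, where $T_1+T_2$ is the tree addition of $T_1$ and $T_2$; (2) $\mathscr{A}_{\phi(T)} = x_1x_2\cdots x_n\,(\mathscr{A}_T + 1)$, where $\phi(T)$ is the root extension of $T$, $n$ is the number of non-sink vertices of $\phi(T)$, and $x_1,\dots,x_n$ are the variables corresponding to all the non-sink vertices of $\phi(T)$.
   Context: A graph $G=(V,E,s)$ is a finite connected undirected multigraph without loops, with a distinguished vertex $s$ called the sink; $\widetilde V = V\setminus\{s\}$. $d_v$ is the degree of $v$ (counted with multiplicity, including edges to $s$) and $\mathrm{wt}(u,v)$ is the number of edges between $u$ and $v$. A sandpile is a function $c:\widetilde V\to\mathbb{Z}_{\ge 0}$. A vertex $v\in\widetilde V$ is unstable if $c(v)\ge d_v$; an unstable vertex may topple, which replaces $c$ by $c'$ with $c'(v)=c(v)-d_v$ and $c'(w)=c(w)+\mathrm{wt}(v,w)$ for $w\in\widetilde V$, $w\ne v$. A sandpile is stable if it has no unstable vertex. Any sequence of topplings of unstable vertices starting at $c$ that ends in a stable sandpile ends in the same stable sandpile $c^\circ$ (the stabilization), with the same number of topplings of each vertex; the vector of these numbers is the toppling vector of the stabilization. Put $a\oplus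 b=(a+b)^\circ$. A stable sandpile $c$ is recurrent if for every sandpile $a$ there is a sandpile $b$ with $a\oplus b=c$; the set of recurrent sandpiles is $\mathscr{S}(G)$. For $v\in\widetilde V$, $1_v$ is the sandpile with one grain at $v$ and none elsewhere. For $\widetilde V=\{v_1,\dots,v_n\}$ with associated variables $x_1,\dots,x_n$, and $c$ recurrent, the avalanche monomial is $\mu_G(c,v_k)=\prod_{i=1}^n x_i^{f_i}$, where $(f_1,\dots,f_n)$ is the toppling vector of the stabilization of $c+1_{v_k}$. The multivariate avalanche polynomial is $\mathscr{A}_G(x_1,\dots,x_n)=\sum_{c\in\mathscr{S}(G)}\sum_{v\in\widetilde V}\mu_G(c,v)$ (it is $0$ if $G$ has only the vertex $s$). Tree operations: for trees $T_1,T_2$ rooted at their sinks $s_1,s_2$, the tree addition $T_1+T_2$ is the tree obtained by identifying $s_1$ and $s_2$; the common vertex is the root and sink. For a tree $T$ rooted at its sink $s$, the root extension (grafting) $\phi(T)$ is obtained from $T$ by adding a new vertex $s'$ and an edge between $s$ and $s'$; $s'$ is the root and sink of $\phi(T)$, so $s$ becomes a non-sink vertex, with its own new variable. *)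

theory Defs
  imports "HOL-Library.Multiset" "HOL-Library.Poly_Mapping"
begin

section \<open>Multigraphs with a sink\<close>

record 'v sink_graph =
  verts :: "'v set"
  edges :: "'v set multiset"
  sink :: 'v

definition nonsink :: "'v sink_graph \<Rightarrow> 'v set" where
  "nonsink G = verts G - {sink G}"

definition wt :: "'v sink_graph \<Rightarrow> 'v \<Rightarrow> 'v \<Rightarrow> nat" where
  "wt G u v = count (edges G) {u, v}"

definition degree :: "'v sink_graph \<Rightarrow> 'v \<Rightarrow> nat" where
  "degree G v = size {#e \<in># edges G. v \<in> e#}"

definition adjacency :: "'v sink_graph \<Rightarrow> ('v \<times> 'v) set" where
  "adjacency G = {(u, v). {u, v} \<in># edges G}"

text \<open>Edges are two-element sets, which excludes loops.\<close>

definition is_graph :: "'v sink_graph \<Rightarrow> bool" where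
  "is_graph G \<longleftrightarrow>
     finite (verts G) \<and> sink G \<in> verts G \<and>
     (\<forall>e \<in># edges G. e \<subseteq> verts G \<and> card e = 2) \<and>
     (\<forall>u \<in> verts G. \<forall>v \<in> verts G. (u, v) \<in> (adjacency G)\<^sup>*)"

text \<open>Two parallel edges between \<open>u\<close> and \<open>v\<close> form the cycle \<open>[u, v]\<close>; a single edge
  does not, since the multiset on the left then contains \<open>{u, v}\<close> twice.\<close>

definition is_cycle :: "'v sink_graph \<Rightarrow> 'v list \<Rightarrow> bool" where
  "is_cycle G vs \<longleftrightarrow>
     2 \<le> length vs \<and> distinct vs \<and>
     mset (map2 (\<lambda>u v. {u, v}) vs (rotate1 vs)) \<subseteq># edges G"

definition is_tree :: "'v sink_graph \<Rightarrow> bool" where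
  "is_tree G \<longleftrightarrow> is_graph G \<and> (\<nexists>vs. is_cycle G vs)"


section \<open>Sandpiles\<close>

text \<open>A sandpile is a function on the non-sink vertices, extended by zero.\<close>

definition sandpiles :: "'v sink_graph \<Rightarrow> ('v \<Rightarrow> nat) set" where
  "sandpiles G = {c. \<forall>v. v \<notin> nonsink G \<longrightarrow> c v = 0}"

definition unstable :: "'v sink_graph \<Rightarrow> ('v \<Rightarrow> nat) \<Rightarrow> 'v \<Rightarrow> bool" where
  "unstable G c v \<longleftrightarrow> v \<in> nonsink G \<and> c v \<ge> degree G v"

definition stable :: "'v sink_graph \<Rightarrow> ('v \<Rightarrow> nat) \<Rightarrow> bool" where
  "stable G c \<longleftrightarrow> (\<forall>v. \<not> unstable G c v)"

text \<open>The subtraction is only used at an unstable vertex, where it does not truncate.\<close>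

definition topple :: "'v sink_graph \<Rightarrow> 'v \<Rightarrow> ('v \<Rightarrow> nat) \<Rightarrow> 'v \<Rightarrow> nat" where
  "topple G v c = (\<lambda>w. if w = v then c v - degree G v
                       else if w \<in> nonsink G then c w + wt G v w
                       else c w)"

inductive topplings ::
    "'v sink_graph \<Rightarrow> ('v \<Rightarrow> nat) \<Rightarrow> 'v list \<Rightarrow> ('v \<Rightarrow> nat) \<Rightarrow> bool"
  for G where
  Nil: "topplings G c [] c"
| Cons: "unstable G c v \<Longrightarrow> topplings G (topple G v c) vs c' \<Longrightarrow> topplings G c (v # vs) c'"

text \<open>On a connected graph every sandpile has a stabilizing sequence of topplings, and both
  descriptions below determine a unique object because sandpile stabilization is abelian.\<close>

definition stabilization :: "'v sink_graph \<Rightarrow> ('v \<Rightarrow> nat) \<Rightarrow> 'v \<Rightarrow> nat" where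
  "stabilization G c = (THE c'. \<exists>vs. topplings G c vs c' \<and> stable G c')"

definition toppling_vector :: "'v sink_graph \<Rightarrow> ('v \<Rightarrow> nat) \<Rightarrow> 'v \<Rightarrow> nat" where
  "toppling_vector G c =
     (THE f. \<exists>vs c'. topplings G c vs c' \<and> stable G c' \<and> f = count_list vs)"

definition stable_sum :: "'v sink_graph \<Rightarrow> ('v \<Rightarrow> nat) \<Rightarrow> ('v \<Rightarrow> nat) \<Rightarrow> 'v \<Rightarrow> nat" where
  "stable_sum G a b = stabilization G (\<lambda>v. a v + b v)"

definition recurrents :: "'v sink_graph \<Rightarrow> ('v \<Rightarrow> nat) set" where
  "recurrents G = {c \<in> sandpiles G. stable G c \<and>
     (\<forall>a \<in> sandpiles G. \<exists>b \<in> sandpiles G. stable_sum G a b = c)}"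

definition grain :: "'v \<Rightarrow> 'v \<Rightarrow> nat" where
  "grain v = (\<lambda>w. if w = v then 1 else 0)"


section \<open>Avalanche polynomials\<close>

text \<open>Integer polynomials with one variable per element of \<^typ>\<open>'v\<close>: finitely supported
  coefficient functions on finitely supported exponent vectors, multiplied by convolution.\<close>

type_synonym 'v mpoly = "('v \<Rightarrow>\<^sub>0 nat) \<Rightarrow>\<^sub>0 int"

definition Var :: "'v \<Rightarrow> 'v mpoly" where
  "Var v = Poly_Mapping.single (Poly_Mapping.single v 1) 1"

definition avalanche_monomial :: "'v sink_graph \<Rightarrow> ('v \<Rightarrow> nat) \<Rightarrow> 'v \<Rightarrow> 'v mpoly" where
  "avalanche_monomial G c v =
     (\<Prod>w \<in> nonsink G. Var w ^ toppling_vector G (\<lambda>u. c u + grain v u) w)"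

definition avalanche_poly :: "'v sink_graph \<Rightarrow> 'v mpoly" where
  "avalanche_poly G = (\<Sum>c \<in> recurrents G. \<Sum>v \<in> nonsink G. avalanche_monomial G c v)"


section \<open>Operations on rooted trees\<close>

definition moved_edges :: "'v \<Rightarrow> 'v sink_graph \<Rightarrow> 'v set multiset" where
  "moved_edges r G = image_mset (\<lambda>e. (\<lambda>v. if v = sink G then r else v) ` e) (edges G)"

text \<open>Both sinks are renamed to \<open>r\<close>. For this to be the identification of the two sinks,
  \<open>r\<close> must not be a non-sink vertex of either tree, and the sets of non-sink vertices must be
  disjoint; \<open>r\<close> may be one of the two old sinks.\<close>

definition tree_add :: "'v \<Rightarrow> 'v sink_graph \<Rightarrow> 'v sink_graph \<Rightarrow> 'v sink_graph" where
  "tree_add r G H =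
     \<lparr>verts = insert r (nonsink G \<union> nonsink H),
      edges = moved_edges r G + moved_edges r H,
      sink = r\<rparr>"

definition root_extension :: "'v \<Rightarrow> 'v sink_graph \<Rightarrow> 'v sink_graph" where
  "root_extension s' G =
     \<lparr>verts = insert s' (verts G),
      edges = add_mset {sink G, s'} (edges G),
      sink = s'\<rparr>"

end

theory Submission imports Defs begin

text \<open>On a tree the reduced Laplacian is invertible over the integers: summing the indicators of
  the sides of the edges on the path from \<open>v\<close> to the sink gives a Green function \<open>F v\<close>, whose
  Laplacian is \<open>1\<close> at \<open>v\<close> and \<open>0\<close> elsewhere. Hence the maximal stable sandpile is the only
  recurrent one, and adding a grain to it at \<open>v\<close> has toppling vector \<open>F v\<close>. Tree addition
  extends the Green functions by zero; root extension adds \<open>1\<close> to each of them, and the new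
  non-sink vertex has the constant Green function \<open>1\<close>.\<close>

section \<open>The Laplacian\<close>

definition lap :: "'v sink_graph \<Rightarrow> ('v \<Rightarrow> int) \<Rightarrow> 'v \<Rightarrow> int" where
  "lap G f w = int (degree G w) * f w - (\<Sum>u\<in>verts G. int (wt G w u) * f u)"

lemma lap_add: "lap G (\<lambda>x. f x + g x) w = lap G f w + lap G g w"
  by (simp add: lap_def algebra_simps sum.distrib)

lemma lap_diff: "lap G (\<lambda>x. f x - g x) w = lap G f w - lap G g w"
  by (simp add: lap_def algebra_simps sum_subtractf)

lemma lap_zero [simp]: "lap G (\<lambda>x. 0) w = 0"
  by (simp add: lap_def)

lemma lap_scale: "lap G (\<lambda>x. k * f x) w = k * lap G f w"
  by (simp add: lap_def algebra_simps sum_distrib_left)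

lemma lap_sum: "lap G (\<lambda>x. \<Sum>i\<in>A. f i x) w = (\<Sum>i\<in>A. lap G (f i) w)"
  by (induction A rule: infinite_finite_induct) (simp_all add: lap_add)

lemma wt_commute: "wt G u v = wt G v u"
  by (simp add: wt_def insert_commute)

lemma adjacency_iff_wt: "(u, v) \<in> adjacency G \<longleftrightarrow> wt G u v > 0"
  by (simp add: adjacency_def wt_def)

lemma sym_adjacency: "sym (adjacency G)"
  by (auto simp: adjacency_def sym_def insert_commute)

text \<open>An edge through \<open>v\<close> has exactly one other endpoint \<open>u\<close>, so it
  is counted in exactly one summand.\<close>

lemma size_incident_edges:
  assumes "finite V" "\<forall>e\<in>#E. e \<subseteq> V \<and> card e = 2"
  shows "size {#e \<in># E. v \<in> e#} = (\<Sum>u\<in>V. count E {v, u})"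
  using assms(2)
proof (induction E)
  case (add e E)
  show ?case
  proof (cases "v \<in> e")
    case True
    then obtain u where u: "e = {v, u}" "u \<noteq> v"
      using add.prems by (fastforce simp: card_2_iff)
    have "(\<Sum>x\<in>V. count (add_mset e E) {v, x}) = (\<Sum>x\<in>V. count E {v, x} + (if x = u then 1 else 0))"
      using u by (intro sum.cong) (auto simp: doubleton_eq_iff)
    also have "\<dots> = (\<Sum>x\<in>V. count E {v, x}) + 1"
      using add.prems u assms(1) by (simp add: sum.distrib)
    finally show ?thesis using add True by simp
  next
    case False
    then have "count (add_mset e E) {v, x} = count E {v, x}" for x by auto
    with False add show ?thesis by simp
  qed
qed simp

text \<open>The maximal stable sandpile. On a connected graph the subtraction does not truncate, by
  \<open>degree_pos\<close>.\<close>

definition cmax :: "'v sink_graph \<Rightarrow> 'v \<Rightarrow> nat" where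
  "cmax G v = (if v \<in> nonsink G then degree G v - 1 else 0)"

text \<open>\<open>f\<close> is the column at \<open>v\<close> of the inverse of the reduced Laplacian; being integral,
  it can exist for every \<open>v\<close> only when the sandpile group is trivial.\<close>

definition green :: "'v sink_graph \<Rightarrow> 'v \<Rightarrow> ('v \<Rightarrow> nat) \<Rightarrow> bool" where
  "green G v f \<longleftrightarrow> (\<forall>w. w \<notin> nonsink G \<longrightarrow> f w = 0) \<and>
     (\<forall>w\<in>nonsink G. lap G (\<lambda>x. int (f x)) w = (if w = v then 1 else 0))"

section \<open>Connected multigraphs and the maximum principle\<close>

locale connected_graph =
  fixes G :: "'v sink_graph"
  assumes is_graph: "is_graph G"
begin

lemma finite_verts [simp]: "finite (verts G)"
  and sink_in_verts [simp]: "sink G \<in> verts G"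
  and edges_ok: "\<forall>e\<in>#edges G. e \<subseteq> verts G \<and> card e = 2"
  and connected: "u \<in> verts G \<Longrightarrow> v \<in> verts G \<Longrightarrow> (u, v) \<in> (adjacency G)\<^sup>*"
  using is_graph by (auto simp: is_graph_def)

lemma finite_nonsink [simp]: "finite (nonsink G)"
  and nonsink_subset: "nonsink G \<subseteq> verts G"
  and sink_notin_nonsink [simp]: "sink G \<notin> nonsink G"
  and nonsinkI: "v \<in> verts G \<Longrightarrow> v \<noteq> sink G \<Longrightarrow> v \<in> nonsink G"
  by (auto simp: nonsink_def)

lemma adjacent_in_verts: "wt G u v > 0 \<Longrightarrow> u \<in> verts G \<and> v \<in> verts G \<and> u \<noteq> v"
  using edges_ok by (fastforce simp: wt_def)

lemma wt_self [simp]: "wt G v v = 0"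
  using adjacent_in_verts by blast

lemma degree_eq_sum_wt: "degree G v = (\<Sum>u\<in>verts G. wt G v u)"
  unfolding degree_def wt_def using edges_ok by (intro size_incident_edges) auto

text \<open>Degrees are sums of weights. In this form constants visibly have Laplacian zero, and at
  a maximum every term is nonnegative.\<close>

lemma lap_eq_sum_diff: "lap G f w = (\<Sum>u\<in>verts G. int (wt G w u) * (f w - f u))"
  by (simp add: lap_def degree_eq_sum_wt algebra_simps sum_subtractf sum_distrib_left)

text \<open>Symmetry of the weights cancels all terms. This recovers the value at the sink from
  those at the non-sink vertices.\<close>

lemma sum_lap_eq_0: "(\<Sum>w\<in>verts G. lap G f w) = 0"
proof -
  have "(\<Sum>w\<in>verts G. \<Sum>u\<in>verts G. int (wt G w u) * f u)
      = (\<Sum>u\<in>verts G. \<Sum>w\<in>verts G. int (wt G u w) * f u)"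
    by (subst sum.swap) (simp add: wt_commute)
  then show ?thesis
    by (simp add: lap_def degree_eq_sum_wt sum_subtractf sum_distrib_right)
qed

lemma sum_verts: "(\<Sum>w\<in>verts G. h w) = h (sink G) + (\<Sum>w\<in>nonsink G. h w)"
  for h :: "'v \<Rightarrow> 'b::comm_monoid_add"
  by (simp add: nonsink_def sum.remove)

lemma lap_indicator:
  assumes "v \<in> verts G"
  shows "lap G (\<lambda>x. if x = v then 1 else 0) w
    = (if w = v then int (degree G v) else - int (wt G v w))"
  using assms by (auto simp: lap_def wt_commute if_distrib cong: if_cong)

text \<open>At a positive maximum the differences to the neighbours are nonnegative and their
  weighted sum is at most zero, so all neighbours attain the maximum too. A path carries the maximum
  to the sink, where \<open>f\<close> is not positive.\<close>

lemma maximum_principle: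
  assumes "\<And>w. w \<in> nonsink G \<Longrightarrow> lap G f w \<le> 0" "f (sink G) \<le> 0" "x \<in> verts G"
  shows "f x \<le> 0"
proof (rule ccontr)
  assume "\<not> f x \<le> 0"
  define M where "M = Max (f ` verts G)"
  have le: "f y \<le> M" if "y \<in> verts G" for y using that by (simp add: M_def)
  then have "M > 0" using \<open>\<not> f x \<le> 0\<close> assms(3) by fastforce
  have "M \<in> f ` verts G" unfolding M_def using assms(3) by (intro Max_in) auto
  then obtain z where z: "z \<in> verts G" "f z = M" by blast
  have "(z, sink G) \<in> (adjacency G)\<^sup>*" using z by (simp add: connected)
  then have "f (sink G) = M"
  proof (induction rule: rtrancl_induct)
    case (step y u)
    from step have yu: "wt G y u > 0" by (simp add: adjacency_iff_wt)
    then have V: "y \<in> verts G" "u \<in> verts G" using adjacent_in_verts by blast+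
    have "y \<noteq> sink G" using step \<open>M > 0\<close> assms(2) by auto
    then have "(\<Sum>u\<in>verts G. int (wt G y u) * (f y - f u)) \<le> 0"
      using assms(1) V nonsinkI by (simp flip: lap_eq_sum_diff)
    moreover have nn: "\<And>u. u \<in> verts G \<Longrightarrow> 0 \<le> int (wt G y u) * (f y - f u)"
      using step le by simp
    ultimately have "(\<Sum>u\<in>verts G. int (wt G y u) * (f y - f u)) = 0"
      by (intro order_antisym sum_nonneg)
    then have "int (wt G y u) * (f y - f u) = 0"
      using sum_nonneg_0[OF finite_verts nn _ V(2)] by simp
    then show ?case using yu step by simp
  qed (use z in simp)
  then show False using \<open>M > 0\<close> assms(2) by simp
qed

lemma degree_pos:
  assumes "v \<in> nonsink G" shows "degree G v > 0"
proof -
  have "(v, sink G) \<in> (adjacency G)\<^sup>*" "v \<noteq> sink G" "v \<in> verts G"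
    using assms by (auto simp: nonsink_def intro: connected)
  then obtain u where u: "wt G v u > 0"
    by (metis adjacency_iff_wt converse_rtranclE)
  then have "wt G v u \<le> degree G v"
    unfolding degree_eq_sum_wt by (intro member_le_sum) (use adjacent_in_verts in auto)
  with u show ?thesis by simp
qed

lemma cmax_less_degree: "v \<in> nonsink G \<Longrightarrow> cmax G v < degree G v"
  using degree_pos by (simp add: cmax_def)


section \<open>Toppling sequences\<close>

lemma topple_eq:
  assumes "unstable G c v" "w \<in> nonsink G"
  shows "int (topple G v c w) = int (c w) - lap G (\<lambda>x. if x = v then 1 else 0) w"
  using assms nonsink_subset by (subst lap_indicator) (auto simp: topple_def unstable_def)

text \<open>Each toppling subtracts the Laplacian of an indicator, so only the number of topplings
  of each vertex matters, not their order.\<close>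

lemma topplings_eq:
  assumes "topplings G c vs c'" "w \<in> nonsink G"
  shows "int (c' w) = int (c w) - lap G (\<lambda>x. int (count_list vs x)) w"
  using assms
proof (induction rule: topplings.induct)
  case (Cons c v vs c')
  have "(\<lambda>x. int (count_list (v # vs) x))
      = (\<lambda>x. int (count_list vs x) + (if x = v then 1 else 0))"
    by auto
  then show ?case
    using Cons topple_eq[OF Cons.hyps(1) Cons.prems] by (simp add: lap_add)
qed simp

lemma topplings_outside:
  assumes "topplings G c vs c'" "w \<notin> nonsink G"
  shows "count_list vs w = 0" "c' w = c w"
  using assms
  by (induction rule: topplings.induct) (auto simp: unstable_def topple_def)

text \<open>The first toppled vertex \<open>v\<close> has at least \<open>degree G v\<close> grains
  but falls below that when \<open>g\<close> is fired. So \<open>lap G g v\<close> is positive and,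
  as \<open>g\<close> is nonnegative, so is \<open>g v\<close>. Taking one firing at
  \<open>v\<close> away from \<open>g\<close> leaves the same situation for the remaining
  topplings.\<close>

lemma least_action:
  assumes "topplings G c vs c'" "\<And>x. 0 \<le> g x"
    "\<And>w. w \<in> nonsink G \<Longrightarrow> int (c w) - lap G g w < int (degree G w)"
  shows "int (count_list vs w) \<le> g w"
  using assms
proof (induction arbitrary: g rule: topplings.induct)
  case (Cons c v vs c')
  define g' where "g' = (\<lambda>x. g x - (if x = v then 1 else 0))"
  have v: "v \<in> nonsink G" "degree G v \<le> c v" using Cons by (auto simp: unstable_def)
  then have "lap G g v > 0" using Cons.prems(2)[of v] by simp
  moreover have "(\<Sum>u\<in>verts G. int (wt G v u) * g u) \<ge> 0"
    using Cons.prems(1) by (simp add: sum_nonneg)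
  ultimately have "g v \<noteq> 0" by (auto simp: lap_def)
  then have "g' x \<ge> 0" for x using Cons.prems(1)[of x] by (auto simp: g'_def)
  moreover have "int (topple G v c w) - lap G g' w < int (degree G w)" if "w \<in> nonsink G" for w
    using Cons.prems(2)[OF that] topple_eq[OF Cons.hyps(1) that] by (simp add: g'_def lap_diff)
  ultimately have "int (count_list vs w) \<le> g' w" by (intro Cons.IH) auto
  then show ?case by (auto simp: g'_def split: if_splits)
qed simp

lemma stable_iff: "stable G c \<longleftrightarrow> (\<forall>w\<in>nonsink G. c w < degree G w)"
  by (auto simp: stable_def unstable_def not_le)

text \<open>Each count vector leads to a stable sandpile, so least action bounds the other one by
  it. This is the uniqueness behind both \<open>THE\<close> definitions.\<close>

lemma topplings_unique:
  assumes "topplings G c us a" "stable G a" "topplings G c vs b" "stable G b"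
  shows "count_list us = count_list vs" "a = b"
proof -
  have le: "count_list us x \<le> count_list vs x"
    if "topplings G c us a" "topplings G c vs b" "stable G b" for us a vs b x
  proof -
    have "int (c w) - lap G (\<lambda>x. int (count_list vs x)) w < int (degree G w)"
      if "w \<in> nonsink G" for w
      using topplings_eq[OF \<open>topplings G c vs b\<close> that] \<open>stable G b\<close> that
      by (auto simp: stable_iff)
    with least_action[OF that(1), of "\<lambda>x. int (count_list vs x)" x] show ?thesis by simp
  qed
  show eq: "count_list us = count_list vs"
    using le[OF assms(1,3,4)] le[OF assms(3,1,2)] by (auto intro: antisym)
  show "a = b"
  proof
    fix w
    show "a w = b w"
    proof (cases "w \<in> nonsink G")
      case True
      then show ?thesis using topplings_eq[OF assms(1) True] topplings_eq[OF assms(3) True] eq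
        by simp
    qed (use topplings_outside assms in metis)
  qed
qed

lemma stabilizationI:
  assumes "topplings G c vs c'" "stable G c'"
  shows "stabilization G c = c'"
  unfolding stabilization_def
  by (rule the_equality) (use assms topplings_unique in blast)+

lemma toppling_vectorI:
  assumes "topplings G c vs c'" "stable G c'"
  shows "toppling_vector G c = count_list vs"
  unfolding toppling_vector_def
proof (rule the_equality)
  fix f assume "\<exists>us a. topplings G c us a \<and> stable G a \<and> f = count_list us"
  then show "f = count_list vs" using topplings_unique(1) assms by blast
qed (use assms in blast)

end


section \<open>Graphs with integral Green functions\<close>

text \<open>Green functions are assumed here instead of acyclicity, so that tree sums and root
  extensions can be treated by exhibiting theirs, without showing that they are trees.\<close>

locale green_graph = connected_graph +
  fixes F :: "'v \<Rightarrow> 'v \<Rightarrow> nat"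
  assumes green: "v \<in> nonsink G \<Longrightarrow> green G v (F v)"
begin

lemma green_outside: "v \<in> nonsink G \<Longrightarrow> w \<notin> nonsink G \<Longrightarrow> F v w = 0"
  and lap_green: "v \<in> nonsink G \<Longrightarrow> w \<in> nonsink G \<Longrightarrow>
    lap G (\<lambda>x. int (F v x)) w = (if w = v then 1 else 0)"
  using green by (auto simp: green_def)

lemma lap_green_sum:
  assumes "w \<in> nonsink G"
  shows "lap G (\<lambda>x. \<Sum>v\<in>nonsink G. int (b v) * int (F v x)) w = int (b w)"
  using assms by (simp add: lap_sum lap_scale lap_green if_distrib cong: if_cong)

text \<open>The weights \<open>h\<close> have Laplacian \<open>1\<close>, so by symmetry of the Laplacian each toppling
  lowers the weighted number of grains by \<open>1\<close>.\<close>

lemma stabilization_exists: "\<exists>vs c'. topplings G c vs c' \<and> stable G c'"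
proof -
  define h where "h x = (\<Sum>v\<in>nonsink G. F v x)" for x
  have h0: "h (sink G) = 0" by (simp add: h_def green_outside)
  have lap_h: "lap G (\<lambda>x. int (h x)) w = 1" if "w \<in> nonsink G" for w
    using lap_green_sum[OF that, of "\<lambda>_. 1"] by (simp add: h_def)
  define pot where "pot c = (\<Sum>w\<in>nonsink G. h w * c w)" for c
  have pot: "pot (topple G v c) < pot c" if "unstable G c v" for v c
  proof -
    have v: "v \<in> nonsink G" using that by (simp add: unstable_def)
    \<comment> \<open>As \<open>h\<close> vanishes at the sink, the sum extends to all vertices;
      there symmetry of the weights moves the Laplacian from the indicator to
      \<open>h\<close>.\<close>
    have "(\<Sum>w\<in>nonsink G. int (h w) * lap G (\<lambda>x. if x = v then 1 else 0) w)
        = (\<Sum>w\<in>verts G. int (h w) * lap G (\<lambda>x. if x = v then 1 else 0) w)"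
      by (simp add: sum_verts h0)
    also have "\<dots> = (\<Sum>w\<in>verts G. (if w = v then int (degree G v) * int (h v) else 0)
        - int (wt G v w) * int (h w))"
      using v nonsink_subset by (intro sum.cong) (auto simp: lap_indicator)
    also have "\<dots> = lap G (\<lambda>x. int (h x)) v"
      using v nonsink_subset by (auto simp: lap_def sum_subtractf)
    finally have "(\<Sum>w\<in>nonsink G. int (h w) * lap G (\<lambda>x. if x = v then 1 else 0) w) = 1"
      by (simp add: lap_h v)
    then have "int (pot (topple G v c)) = int (pot c) - 1"
      by (simp add: pot_def topple_eq[OF that] right_diff_distrib sum_subtractf)
    then show ?thesis by simp
  qed
  show ?thesis
  proof (induction c rule: measure_induct_rule[of pot])
    case (less c)
    show ?case
    proof (cases "stable G c")
      case False
      then obtain v where "unstable G c v" by (auto simp: stable_def)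
      then show ?thesis using less pot topplings.Cons by metis
    qed (use topplings.Nil in blast)
  qed
qed

text \<open>Firing \<open>g\<close> leads from \<open>c\<close> to \<open>cmax\<close>. By the least action principle the actual toppling
  vector is at most \<open>g\<close>; the difference is subharmonic because no stable sandpile exceeds
  \<open>cmax\<close>, so it vanishes by the maximum principle.\<close>

lemma stabilizes_to_cmax:
  fixes g :: "'v \<Rightarrow> nat"
  assumes g0: "\<And>w. w \<notin> nonsink G \<Longrightarrow> g w = 0"
    and c0: "\<And>w. w \<notin> nonsink G \<Longrightarrow> c w = 0"
    and c: "\<And>w. w \<in> nonsink G \<Longrightarrow> int (c w) = int (cmax G w) + lap G (\<lambda>x. int (g x)) w"
  shows "stabilization G c = cmax G" "toppling_vector G c = g"
proof -
  obtain vs c' where vs: "topplings G c vs c'" "stable G c'"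
    using stabilization_exists by blast
  have le: "count_list vs x \<le> g x" for x
    using least_action[OF vs(1), of "\<lambda>x. int (g x)" x] c cmax_less_degree by simp
  have "int (g x) - int (count_list vs x) \<le> 0" if "x \<in> verts G" for x
  proof (rule maximum_principle[OF _ _ that])
    show "lap G (\<lambda>x. int (g x) - int (count_list vs x)) w \<le> 0" if w: "w \<in> nonsink G" for w
      using c[OF w] topplings_eq[OF vs(1) w] vs(2) w
      by (auto simp: lap_diff stable_iff cmax_def)
  qed (simp add: g0)
  then have eq: "count_list vs x = g x" for x
    using le[of x] g0[of x] nonsink_subset by (cases "x \<in> nonsink G") force+
  show "toppling_vector G c = g" using toppling_vectorI[OF vs] eq by auto
  have "c' = cmax G"
  proof
    fix w show "c' w = cmax G w"
    proof (cases "w \<in> nonsink G")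
      case True
      then show ?thesis using topplings_eq[OF vs(1) True] c[OF True] eq by simp
    qed (use topplings_outside(2)[OF vs(1)] c0 in \<open>simp add: cmax_def\<close>)
  qed
  then show "stabilization G c = cmax G" using stabilizationI[OF vs] by simp
qed

text \<open>By superposition, \<open>b\<close> is itself the Laplacian of the integral vector
  \<open>g\<close>, so firing \<open>g\<close> removes the added grains.\<close>

lemma cmax_absorbs:
  assumes "b \<in> sandpiles G"
  shows "stabilization G (\<lambda>w. cmax G w + b w) = cmax G"
proof (rule stabilizes_to_cmax(1)[where g = "\<lambda>x. \<Sum>v\<in>nonsink G. b v * F v x"])
  fix w assume "w \<in> nonsink G"
  then show "int (cmax G w + b w)
      = int (cmax G w) + lap G (\<lambda>x. int (\<Sum>v\<in>nonsink G. b v * F v x)) w"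
    using lap_green_sum by simp
qed (use assms in \<open>auto simp: green_outside cmax_def sandpiles_def\<close>)

text \<open>Recurrence tested against \<open>a = cmax G\<close> forces \<open>c = cmax G\<close>,
  since \<open>cmax G\<close> absorbs every sandpile. Conversely, \<open>cmax G\<close> is reached
  from any \<open>a\<close> by adding \<open>cmax G\<close> itself.\<close>

lemma recurrents_eq: "recurrents G = {cmax G}"
proof -
  have cmax: "cmax G \<in> sandpiles G" "stable G (cmax G)"
    using cmax_less_degree by (auto simp: sandpiles_def stable_iff cmax_def)
  have "\<exists>b\<in>sandpiles G. stable_sum G a b = cmax G" if "a \<in> sandpiles G" for a
    using cmax_absorbs[OF that] cmax(1) by (auto simp: stable_sum_def add.commute)
  moreover have "c = cmax G" if "c \<in> recurrents G" for c
    using that cmax(1) cmax_absorbs by (auto simp: recurrents_def stable_sum_def)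
  ultimately show ?thesis using cmax by (auto simp: recurrents_def)
qed

lemma avalanche_poly_eq:
  "avalanche_poly G = (\<Sum>v\<in>nonsink G. \<Prod>w\<in>nonsink G. Var w ^ F v w)"
proof -
  \<comment> \<open>The added grain at \<open>v\<close> is the Laplacian of \<open>F v\<close>, so
    firing \<open>F v\<close> leads back to \<open>cmax G\<close>.\<close>
  have "toppling_vector G (\<lambda>u. cmax G u + grain v u) = F v" if "v \<in> nonsink G" for v
    by (rule stabilizes_to_cmax(2))
      (use that in \<open>auto simp: green_outside lap_green cmax_def grain_def\<close>)
  then show ?thesis by (simp add: avalanche_poly_def recurrents_eq avalanche_monomial_def)
qed

end


section \<open>Trees\<close>

lemma rtrancl_distinct_path:
  assumes "(x, y) \<in> R\<^sup>*"
  shows "\<exists>p. last (x # p) = y \<and> distinct (x # p) \<and> successively (\<lambda>a b. (a, b) \<in> R) (x # p)"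
  using assms
proof (induction rule: converse_rtrancl_induct)
  case base
  show ?case by (intro exI[of _ "[]"]) simp
next
  case (step x z)
  then obtain p where p: "last (z # p) = y" "distinct (z # p)"
    "successively (\<lambda>a b. (a, b) \<in> R) (z # p)" by blast
  show ?case
  proof (cases "x \<in> set (z # p)")
    case True
    \<comment> \<open>The part of the path from the occurrence of \<open>x\<close> onwards is
      already a distinct path starting at \<open>x\<close>.\<close>
    then obtain p1 p2 where "z # p = p1 @ x # p2" by (meson split_list)
    with p show ?thesis
      by (intro exI[of _ p2]) (auto simp: successively_append_iff)
  next
    case False
    with p step show ?thesis by (intro exI[of _ "z # p"]) auto
  qed
qed

text \<open>For \<open>y = x\<close> the list \<open>q @ [x]\<close> is
  \<open>rotate1 (x # q)\<close>, so this separates the closing edge of a cycle from the edges of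
  the path.\<close>

lemma map2_snoc: "map2 f (x # q) (q @ [y]) = map2 f (x # q) q @ [f (last (x # q)) y]"
  by (induction q arbitrary: x) auto

text \<open>The first edge contains \<open>x\<close>, which lies on no later edge; the bound on the
  union carries this through the induction.\<close>

lemma distinct_path_edges:
  assumes "distinct (x # q)"
  shows "distinct (map2 (\<lambda>u v. {u, v}) (x # q) q)
    \<and> \<Union>(set (map2 (\<lambda>u v. {u, v}) (x # q) q)) \<subseteq> set (x # q)"
  using assms
proof (induction q arbitrary: x)
  case (Cons y q)
  let ?P = "map2 (\<lambda>u v. {u, v}) (y # q) q"
  have IH: "distinct ?P" "\<Union>(set ?P) \<subseteq> set (y # q)" using Cons by auto
  moreover have "{x, y} \<notin> set ?P" using IH(2) Cons.prems by (meson UnionI distinct.simps(2) insertI1 subsetD)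
  moreover have "map2 (\<lambda>u v. {u, v}) (x # y # q) (y # q) = {x, y} # ?P" by simp
  ultimately show ?case by (simp only: distinct.simps(2) list.set Union_insert) auto
qed simp

lemma path_edges_in:
  assumes "successively (\<lambda>a b. {a, b} \<in># E) (x # q)"
  shows "set (map2 (\<lambda>u v. {u, v}) (x # q) q) \<subseteq> set_mset E"
  using assms by (induction q arbitrary: x) auto

lemma distinct_mset_subseteq:
  assumes "distinct xs" "set xs \<subseteq> set_mset M"
  shows "mset xs \<subseteq># M"
proof (rule mset_subset_eqI)
  fix a
  show "count (mset xs) a \<le> count M a"
    using assms by (cases "a \<in> set xs") (auto simp: distinct_count_atmost_1 Suc_le_eq)
qed

text \<open>A simple path from \<open>v\<close> to \<open>u\<close> is closed up by the removed copy
  of the edge. Removing only one copy lets a parallel edge serve as the bypass.\<close>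

lemma cycle_of_bypass:
  assumes e: "{v, u} \<in># edges G" "v \<noteq> u"
    and path: "(v, u) \<in> {(x, y). {x, y} \<in># edges G - {#{v, u}#}}\<^sup>*"
  shows "\<exists>vs. is_cycle G vs"
proof -
  obtain q where q: "last (v # q) = u" "distinct (v # q)"
    "successively (\<lambda>a b. {a, b} \<in># edges G - {#{v, u}#}) (v # q)"
    using rtrancl_distinct_path[OF path] by auto
  have "mset (map2 (\<lambda>u v. {u, v}) (v # q) q) \<subseteq># edges G - {#{v, u}#}"
    using distinct_path_edges[OF q(2)] path_edges_in[OF q(3)]
    by (intro distinct_mset_subseteq) auto
  then have "mset (map2 (\<lambda>u v. {u, v}) (v # q) (q @ [v])) \<subseteq># edges G"
    using q(1) e(1) unfolding map2_snoc by (simp add: insert_commute insert_subset_eq_iff)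
  moreover have "q \<noteq> []" using q(1) e(2) by auto
  ultimately have "is_cycle G (v # q)"
    using q(2) by (cases q) (auto simp: is_cycle_def)
  then show ?thesis ..
qed

section \<open>Green functions of acyclic graphs\<close>

context connected_graph
begin

text \<open>Every edge of a tree is a bridge; \<open>f\<close> is the indicator of its side containing \<open>v\<close>.\<close>

lemma bridge_potential:
  assumes acyclic: "\<nexists>vs. is_cycle G vs" and e: "{v, u} \<in># edges G"
  shows "\<exists>f. \<forall>w\<in>verts G. lap G f w = (if w = v then 1 else 0) - (if w = u then 1 else 0)"
proof -
  define R where "R = {(x, y). {x, y} \<in># edges G - {#{v, u}#}}"
  define D where "D = R\<^sup>* `` {v}"
  have V: "v \<in> verts G" "u \<in> verts G" "v \<noteq> u"
    using adjacent_in_verts[of v u] e by (auto simp: wt_def)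
  have vD: "v \<in> D" by (simp add: D_def)
  have uD: "u \<notin> D" using cycle_of_bypass[OF e V(3)] acyclic by (auto simp: D_def R_def)
  have closed: "x \<in> D \<longleftrightarrow> y \<in> D" if "{x, y} \<in># edges G - {#{v, u}#}" for x y
  proof -
    from that have "(x, y) \<in> R" "(y, x) \<in> R" by (auto simp: R_def insert_commute)
    then show ?thesis by (auto simp: D_def intro: rtrancl_into_rtrancl)
  qed
  \<comment> \<open>A second copy of the edge would survive the removal and put \<open>u\<close>
    into \<open>D\<close>.\<close>
  have single: "wt G v u = 1"
  proof -
    have "{v, u} \<notin># edges G - {#{v, u}#}" using closed[of v u] vD uD by blast
    then have "count (edges G) {v, u} \<le> 1" by (simp add: not_in_iff)
    moreover have "1 \<le> count (edges G) {v, u}" using e by simp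
    ultimately show ?thesis unfolding wt_def by (rule le_antisym)
  qed
  define f :: "'v \<Rightarrow> int" where "f x = (if x \<in> D then 1 else 0)" for x
  \<comment> \<open>Every edge other than \<open>{v, u}\<close> has both ends on the same side, so
    only the ordered pairs \<open>(v, u)\<close> and \<open>(u, v)\<close> contribute.\<close>
  have contribution: "int (wt G w x) * (f w - f x)
      = (if w = v \<and> x = u then 1 else 0) - (if w = u \<and> x = v then 1 else 0)" for w x
  proof (cases "{w, x} = {v, u}")
    case True
    then show ?thesis using single vD uD V(3)
      by (auto simp: doubleton_eq_iff f_def wt_commute)
  next
    case False
    then have "wt G w x = 0 \<or> f w = f x"
      using closed[of w x] by (auto simp: f_def wt_def in_diff_count simp flip: not_in_iff)
    then have "int (wt G w x) * (f w - f x) = 0" by simp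
    moreover have "\<not> (w = v \<and> x = u)" "\<not> (w = u \<and> x = v)" using False by auto
    ultimately show ?thesis by (simp only: if_False)
  qed
  have "lap G f w = (if w = v then 1 else 0) - (if w = u then 1 else 0)" if "w \<in> verts G" for w
    unfolding lap_eq_sum_diff contribution sum_subtractf
    using V by (cases "w = v"; cases "w = u") simp_all
  then show ?thesis by blast
qed

text \<open>The edge potentials along a path from \<open>v\<close> to the sink telescope.
  Subtracting the value at the sink changes no Laplacian, and the maximum principle for the negated
  function then gives nonnegativity.\<close>

lemma green_exists:
  assumes acyclic: "\<nexists>vs. is_cycle G vs" and v: "v \<in> nonsink G"
  shows "\<exists>f. green G v f"
proof -
  have "(v, sink G) \<in> (adjacency G)\<^sup>*" using v nonsink_subset connected by auto
  then have "\<exists>f. \<forall>w\<in>nonsink G. lap G f w = (if w = v then 1 else 0)"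
  proof (induction rule: converse_rtrancl_induct)
    case base
    show ?case by (intro exI[of _ "\<lambda>_. 0"]) (use sink_notin_nonsink in auto)
  next
    case (step v u)
    then obtain f where f: "\<forall>w\<in>nonsink G. lap G f w = (if w = u then 1 else 0)" by blast
    from step have "{v, u} \<in># edges G" by (simp add: adjacency_def)
    then obtain g where
      g: "\<forall>w\<in>verts G. lap G g w = (if w = v then 1 else 0) - (if w = u then 1 else 0)"
      using bridge_potential[OF acyclic] by blast
    show ?case
      using f g nonsink_subset by (intro exI[of _ "\<lambda>x. f x + g x"]) (auto simp: lap_add)
  qed
  then obtain f where f: "\<forall>w\<in>nonsink G. lap G f w = (if w = v then 1 else 0)" by blast
  define g where "g x = f x - f (sink G)" for x
  have lap_g: "lap G g w = (if w = v then 1 else 0)" if "w \<in> nonsink G" for w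
    using f that by (simp add: lap_eq_sum_diff g_def)
  have nonneg: "0 \<le> g x" if "x \<in> verts G" for x
  proof -
    have "lap G (\<lambda>x. 0 - g x) w \<le> 0" if "w \<in> nonsink G" for w
      using lap_g[OF that] by (simp only: lap_diff lap_zero) simp
    moreover have "0 - g (sink G) \<le> 0" by (simp add: g_def)
    ultimately have "0 - g x \<le> 0" by (rule maximum_principle[OF _ _ that])
    then show ?thesis by simp
  qed
  define h where "h x = (if x \<in> nonsink G then nat (g x) else 0)" for x
  have h: "int (h x) = g x" if "x \<in> verts G" for x
    using nonneg[OF that] nonsinkI[OF that] by (auto simp: h_def g_def)
  have "lap G (\<lambda>x. int (h x)) w = (if w = v then 1 else 0)" if "w \<in> nonsink G" for w
  proof -
    have "w \<in> verts G" using that nonsink_subset by blast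
    then have "lap G (\<lambda>x. int (h x)) w = lap G g w" by (simp add: lap_def h)
    then show ?thesis by (simp add: lap_g that)
  qed
  then have "green G v h" by (simp add: green_def h_def)
  then show ?thesis by blast
qed

end

lemma tree_green:
  assumes "is_tree G"
  obtains F where "green_graph G F"
proof -
  interpret connected_graph G using assms by unfold_locales (simp add: is_tree_def)
  have "\<forall>v\<in>nonsink G. \<exists>f. green G v f"
    using green_exists assms by (auto simp: is_tree_def)
  then obtain F where "\<forall>v\<in>nonsink G. green G v (F v)" by metis
  then have "green_graph G F" by unfold_locales blast
  then show ?thesis by (rule that)
qed

text \<open>Adjacency is symmetric, so two paths to the sink join into one between their starting
  points.\<close>

lemma is_graphI:
  assumes "finite (verts G)" "sink G \<in> verts G" "\<And>e. e \<in># edges G \<Longrightarrow> e \<subseteq> verts G \<and> card e = 2"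
    "\<And>v. v \<in> verts G \<Longrightarrow> (v, sink G) \<in> (adjacency G)\<^sup>*"
  shows "is_graph G"
proof -
  have "(u, v) \<in> (adjacency G)\<^sup>*" if "u \<in> verts G" "v \<in> verts G" for u v
    using assms(4)[OF that(1)] assms(4)[OF that(2)] sym_rtrancl[OF sym_adjacency]
    by (meson rtrancl_trans symD)
  then show ?thesis using assms by (simp add: is_graph_def)
qed


section \<open>Tree addition\<close>

lemma nonsink_tree_add:
  assumes "r \<notin> nonsink G \<union> nonsink H"
  shows "nonsink (tree_add r G H) = nonsink G \<union> nonsink H"
  using assms by (auto simp: nonsink_def tree_add_def)

lemma tree_add_commute: "tree_add r G H = tree_add r H G"
  by (simp add: tree_add_def Un_commute add.commute)

section \<open>Renaming the sink\<close>

context connected_graph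
begin

lemma inj_on_move:
  assumes "r \<notin> nonsink G"
  shows "inj_on (\<lambda>v. if v = sink G then r else v) (verts G)"
  using assms by (auto simp: inj_on_def nonsink_def)

lemma moved_edges_ok:
  assumes "r \<notin> nonsink G" "e \<in># moved_edges r G"
  shows "e \<subseteq> insert r (nonsink G) \<and> card e = 2"
proof -
  define m where "m v = (if v = sink G then r else v)" for v
  have inj: "inj_on m (verts G)"
    unfolding m_def by (rule inj_on_move[OF assms(1)])
  have "e \<in># image_mset (image m) (edges G)"
    using assms(2) unfolding moved_edges_def m_def .
  then obtain e' where e': "e' \<in># edges G" "e = m ` e'" by auto
  with edges_ok have "e' \<subseteq> verts G" "card e' = 2" by auto
  moreover have "m ` verts G \<subseteq> insert r (nonsink G)" by (auto simp: m_def nonsink_def)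
  ultimately show ?thesis
    using e'(2) card_image[OF inj_on_subset[OF inj]] by auto
qed

text \<open>The renaming is injective on vertices and fixes \<open>u\<close> and \<open>v\<close>,
  so no other edge can become \<open>{u, v}\<close>.\<close>

lemma count_moved_edges:
  assumes "r \<notin> nonsink G" "u \<in> nonsink G" "v \<in> nonsink G"
  shows "count (moved_edges r G) {u, v} = count (edges G) {u, v}"
proof -
  define m where "m v = (if v = sink G then r else v)" for v
  have inj: "inj_on m (verts G)"
    unfolding m_def by (rule inj_on_move[OF assms(1)])
  have m: "moved_edges r G = image_mset (image m) (edges G)"
    unfolding moved_edges_def m_def ..
  have uv: "m ` {u, v} = {u, v}" using assms by (auto simp: m_def nonsink_def)
  have "m ` e = {u, v} \<longleftrightarrow> e = {u, v}" if "e \<in># edges G" for e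
  proof -
    have "{u, v} \<subseteq> verts G" "e \<subseteq> verts G"
      using assms nonsink_subset edges_ok that by auto
    then show ?thesis using inj_on_image_eq_iff[OF inj, of e "{u, v}"] uv by simp
  qed
  then have "{#e \<in># edges G. m ` e = {u, v}#} = {#e \<in># edges G. e = {u, v}#}"
    by (intro filter_mset_cong) auto
  then show ?thesis
    by (simp add: m count_conv_size_mset filter_mset_image_mset)
qed

lemma degree_moved_edges:
  assumes "v \<in> nonsink G" "r \<notin> nonsink G"
  shows "size {#e \<in># moved_edges r G. v \<in> e#} = degree G v"
proof -
  have "v \<in> (\<lambda>v. if v = sink G then r else v) ` e \<longleftrightarrow> v \<in> e" for e
    using assms by (auto simp: image_iff nonsink_def)
  then show ?thesis by (simp add: moved_edges_def filter_mset_image_mset degree_def)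
qed

text \<open>Renaming carries a path to the old sink, edge by edge, to a path to \<open>r\<close>.
  Allowing any \<open>H\<close> that contains the moved edges serves both summands of a tree
  addition.\<close>

lemma moved_edges_connected:
  assumes "v \<in> nonsink G" "moved_edges r G \<subseteq># edges H"
  shows "(v, r) \<in> (adjacency H)\<^sup>*"
proof -
  define m where "m v = (if v = sink G then r else v)" for v
  have m: "moved_edges r G = image_mset (image m) (edges G)"
    unfolding moved_edges_def m_def ..
  have "(v, sink G) \<in> (adjacency G)\<^sup>*" using assms(1) nonsink_subset connected by auto
  then have "(m v, m (sink G)) \<in> (adjacency H)\<^sup>*"
  proof (induction rule: converse_rtrancl_induct)
    case (step x y)
    then have "{x, y} \<in># edges G" by (simp add: adjacency_def)
    then have "m ` {x, y} \<in># moved_edges r G" unfolding m set_image_mset by (rule imageI)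
    then have "(m x, m y) \<in> adjacency H"
      using assms(2) by (auto simp: adjacency_def dest: mset_subset_eqD)
    then show ?case using step by auto
  qed simp
  then show ?thesis using assms(1) by (auto simp: m_def nonsink_def)
qed

end

lemma is_graph_tree_add:
  assumes "is_graph G" "is_graph H" "r \<notin> nonsink G \<union> nonsink H"
  shows "is_graph (tree_add r G H)"
proof -
  interpret G: connected_graph G by unfold_locales fact
  interpret H: connected_graph H by unfold_locales fact
  show ?thesis
  proof (rule is_graphI)
    fix e assume "e \<in># edges (tree_add r G H)"
    then show "e \<subseteq> verts (tree_add r G H) \<and> card e = 2"
      using G.moved_edges_ok H.moved_edges_ok assms(3) by (fastforce simp: tree_add_def)
  next
    fix v assume "v \<in> verts (tree_add r G H)"
    then show "(v, sink (tree_add r G H)) \<in> (adjacency (tree_add r G H))\<^sup>*"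
      using G.moved_edges_connected[of v r "tree_add r G H"]
        H.moved_edges_connected[of v r "tree_add r G H"]
      by (auto simp: tree_add_def)
  qed (simp_all add: tree_add_def)
qed

text \<open>At a non-sink vertex of \<open>G\<close>, neither the degree nor the weights to non-sink
  vertices of \<open>G\<close> change. At a non-sink vertex of \<open>H\<close>, \<open>f\<close>
  vanishes, as it does at all neighbours.\<close>

lemma green_tree_add:
  assumes G: "is_graph G" and H: "is_graph H"
    and disj: "nonsink G \<inter> nonsink H = {}" and r: "r \<notin> nonsink G \<union> nonsink H"
    and f: "green G v f" and v: "v \<in> nonsink G"
  shows "green (tree_add r G H) v f"
proof -
  interpret G: connected_graph G by unfold_locales fact
  interpret H: connected_graph H by unfold_locales fact
  let ?S = "tree_add r G H"
  interpret S: connected_graph ?S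
    by unfold_locales (rule is_graph_tree_add[OF G H r])
  note nonsink = nonsink_tree_add[OF r]
  have f0: "f w = 0" if "w \<notin> nonsink G" for w using f that by (simp add: green_def)
  \<comment> \<open>As \<open>f\<close> vanishes off \<open>nonsink G\<close>, only weights to
    \<open>nonsink G\<close> matter in either graph; edges to the sink enter through the degree
    alone.\<close>
  have lap: "lap K (\<lambda>x. int (f x)) w
      = int (degree K w) * int (f w) - (\<Sum>u\<in>nonsink G. int (wt K w u) * int (f u))"
    if "finite (verts K)" "nonsink G \<subseteq> verts K" for K w
    unfolding lap_def using that f0 by (simp add: sum.mono_neutral_right)
  have lapG: "lap G (\<lambda>x. int (f x)) w
      = int (degree G w) * int (f w) - (\<Sum>u\<in>nonsink G. int (wt G w u) * int (f u))" for w
    by (rule lap) (use G.nonsink_subset in auto)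
  have lapS: "lap ?S (\<lambda>x. int (f x)) w
      = int (degree ?S w) * int (f w) - (\<Sum>u\<in>nonsink G. int (wt ?S w u) * int (f u))" for w
    by (rule lap) (use S.nonsink_subset nonsink in auto)
  have H0: "w \<notin> e" if "e \<in># moved_edges r H" "w \<in> nonsink G" for e w
    using H.moved_edges_ok[of r e] that r disj by auto
  have G0: "w \<notin> e" if "e \<in># moved_edges r G" "w \<in> nonsink H" for e w
    using G.moved_edges_ok[of r e] that r disj by auto
  have H0': "count (moved_edges r H) {w, u} = 0" if "u \<in> nonsink G" for w u
    using H0[of "{w, u}" u] that by (auto simp: count_eq_zero_iff)
  have G0': "count (moved_edges r G) {w, u} = 0" if "w \<in> nonsink H" for w u
    using G0[of "{w, u}" w] that by (auto simp: count_eq_zero_iff)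
  have "lap ?S (\<lambda>x. int (f x)) w = (if w = v then 1 else 0)" if "w \<in> nonsink ?S" for w
  proof (cases "w \<in> nonsink G")
    case True
    have "{#e \<in># moved_edges r H. w \<in> e#} = {#}"
      using H0 True by auto
    then have "degree ?S w = degree G w"
      using G.degree_moved_edges[OF True] r unfolding degree_def[of ?S] by (simp add: tree_add_def)
    moreover have "wt ?S w u = wt G w u" if "u \<in> nonsink G" for u
      using G.count_moved_edges[OF _ True that] H0'[OF that] r by (simp add: wt_def tree_add_def)
    ultimately have "lap ?S (\<lambda>x. int (f x)) w = lap G (\<lambda>x. int (f x)) w"
      by (simp add: lapS lapG)
    then show ?thesis using f True by (simp add: green_def)
  next
    case False
    then have "w \<in> nonsink H" using that nonsink by auto
    then have "wt ?S w u = 0" if "u \<in> nonsink G" for u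
      using G0' H0'[OF that] by (simp add: wt_def tree_add_def)
    then show ?thesis using False f0 v by (auto simp: lapS)
  qed
  then show ?thesis using f0 nonsink by (simp add: green_def)
qed

lemma avalanche_poly_tree_add:
  assumes "is_tree G" "is_tree H" "nonsink G \<inter> nonsink H = {}" "r \<notin> nonsink G \<union> nonsink H"
  shows "avalanche_poly (tree_add r G H) = avalanche_poly G + avalanche_poly H"
proof -
  obtain A where "green_graph G A" using tree_green[OF assms(1)] .
  then interpret A: green_graph G A .
  obtain B where "green_graph H B" using tree_green[OF assms(2)] .
  then interpret B: green_graph H B .
  define F where "F v = (if v \<in> nonsink G then A v else B v)" for v
  note nonsink = nonsink_tree_add[OF assms(4)]
  interpret F: green_graph "tree_add r G H" F
  proof
    show "is_graph (tree_add r G H)"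
      by (rule is_graph_tree_add[OF A.is_graph B.is_graph assms(4)])
    fix v assume v: "v \<in> nonsink (tree_add r G H)"
    show "green (tree_add r G H) v (F v)"
    proof (cases "v \<in> nonsink G")
      case True
      then show ?thesis
        using green_tree_add[OF A.is_graph B.is_graph assms(3,4) A.green] by (simp add: F_def)
    next
      case False
      then have "v \<in> nonsink H" using v nonsink by auto
      then show ?thesis
        using green_tree_add[OF B.is_graph A.is_graph, of r v "B v"] B.green assms(3,4) False
        by (simp add: F_def tree_add_commute[of r H] Int_commute Un_commute)
    qed
  qed
  \<comment> \<open>The variables of the other tree have exponent zero.\<close>
  have "(\<Prod>w\<in>nonsink G \<union> nonsink H. Var w ^ F v w) = (\<Prod>w\<in>nonsink G. Var w ^ A v w)"
    if "v \<in> nonsink G" for v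
    using that A.green_outside[OF that] by (intro prod.mono_neutral_cong_right) (auto simp: F_def)
  moreover have "(\<Prod>w\<in>nonsink G \<union> nonsink H. Var w ^ F v w) = (\<Prod>w\<in>nonsink H. Var w ^ B v w)"
    if "v \<in> nonsink H" for v
    using that assms(3) B.green_outside[OF that]
    by (intro prod.mono_neutral_cong_right) (auto simp: F_def)
  ultimately show ?thesis
    using assms(3)
    by (simp add: F.avalanche_poly_eq A.avalanche_poly_eq B.avalanche_poly_eq nonsink
        sum.union_disjoint)
qed


section \<open>Root extension\<close>

context connected_graph
begin

lemma nonsink_root_extension: "s' \<notin> verts G \<Longrightarrow> nonsink (root_extension s' G) = verts G"
  by (auto simp: nonsink_def root_extension_def)

lemma is_graph_root_extension:
  assumes "s' \<notin> verts G"
  shows "is_graph (root_extension s' G)"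
proof (rule is_graphI)
  have "sink G \<noteq> s'" using assms sink_in_verts by metis
  fix e assume "e \<in># edges (root_extension s' G)"
  then show "e \<subseteq> verts (root_extension s' G) \<and> card e = 2"
    using edges_ok \<open>sink G \<noteq> s'\<close> by (auto simp: root_extension_def)
next
  fix v assume v: "v \<in> verts (root_extension s' G)"
  have "adjacency G \<subseteq> adjacency (root_extension s' G)"
    by (auto simp: adjacency_def root_extension_def)
  then have "(v, sink G) \<in> (adjacency (root_extension s' G))\<^sup>*" if "v \<in> verts G"
    using connected[OF that sink_in_verts] rtrancl_mono by blast
  moreover have "(sink G, s') \<in> adjacency (root_extension s' G)"
    by (simp add: adjacency_def root_extension_def)
  ultimately show "(v, sink (root_extension s' G)) \<in> (adjacency (root_extension s' G))\<^sup>*"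
    using v by (auto simp: root_extension_def intro: rtrancl_into_rtrancl)
qed (simp_all add: root_extension_def)

text \<open>Adding a constant does not change the Laplacian in \<open>G\<close>. The only edge to
  the new sink starts at the old sink, where the shifted value is 1 and drops to 0.\<close>

lemma lap_root_extension:
  assumes "s' \<notin> verts G" "w \<in> verts G" "f (sink G) = 0"
  shows "lap (root_extension s' G) (\<lambda>x. if x \<in> verts G then f x + 1 else 0) w
    = lap G f w + (if w = sink G then 1 else 0)"
proof -
  have "degree (root_extension s' G) w = degree G w + (if w = sink G then 1 else 0)"
    using assms by (auto simp: degree_def root_extension_def)
  moreover have "wt (root_extension s' G) w u = wt G w u" if "u \<in> verts G" for u
    using assms that by (auto simp: wt_def root_extension_def doubleton_eq_iff)
  ultimately show ?thesis using assms
    by (simp add: lap_def root_extension_def degree_eq_sum_wt algebra_simps sum.distrib)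
qed

end

lemma avalanche_poly_root_extension:
  assumes "is_tree G" "s' \<notin> verts G"
  shows "avalanche_poly (root_extension s' G)
    = (\<Prod>v\<in>nonsink (root_extension s' G). Var v) * (avalanche_poly G + 1)"
proof -
  obtain A where "green_graph G A" using tree_green[OF assms(1)] .
  then interpret A: green_graph G A .
  let ?E = "root_extension s' G"
  \<comment> \<open>For the old sink, now a non-sink vertex, \<open>A'\<close> is zero, so that
    \<open>F\<close> is constantly 1 on the old vertices.\<close>
  define A' where "A' v x = (if v = sink G then 0 else A v x)" for v x
  define F where "F v x = (if x \<in> verts G then A' v x + 1 else 0)" for v x
  note nonsink = A.nonsink_root_extension[OF assms(2)]
  have A'0: "A' v (sink G) = 0" if "v \<in> verts G" for v
    using A.green_outside[of v] A.nonsinkI that by (auto simp: A'_def)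
  interpret F: green_graph ?E F
  proof
    show "is_graph ?E" by (rule A.is_graph_root_extension[OF assms(2)])
    fix v assume "v \<in> nonsink ?E"
    then have v: "v \<in> verts G" using nonsink by simp
    have ns: "lap G (\<lambda>x. int (A' v x)) w = (if w = v then 1 else 0)" if "w \<in> nonsink G" for w
    proof (cases "v = sink G")
      case True
      with that show ?thesis by (auto simp: A'_def)
    next
      case False
      then show ?thesis using A.lap_green[OF A.nonsinkI[OF v] that] by (simp add: A'_def)
    qed
    \<comment> \<open>The Laplacian sums to zero over all vertices, so for \<open>v\<close> other
      than the old sink it is -1 there; the 1 from \<open>lap_root_extension\<close> cancels
      this.\<close>
    have s: "lap G (\<lambda>x. int (A' v x)) (sink G) = (if sink G = v then 0 else - 1)"
    proof -
      have "(\<Sum>w\<in>nonsink G. lap G (\<lambda>x. int (A' v x)) w) = (if v \<in> nonsink G then 1 else 0)"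
        by (simp add: ns)
      then show ?thesis
        using A.sum_lap_eq_0[of "\<lambda>x. int (A' v x)"] v A.nonsinkI
        by (auto simp: A.sum_verts split: if_splits)
    qed
    have "lap ?E (\<lambda>x. int (F v x)) w = (if w = v then 1 else 0)" if "w \<in> verts G" for w
    proof -
      have "(\<lambda>x. int (F v x)) = (\<lambda>x. if x \<in> verts G then int (A' v x) + 1 else 0)"
        by (auto simp: F_def)
      then show ?thesis
        using A.lap_root_extension[OF assms(2) that, of "\<lambda>x. int (A' v x)"] A'0[OF v] ns s
          A.nonsinkI[OF that] by auto
    qed
    then show "green ?E v (F v)" unfolding green_def nonsink by (simp add: F_def)
  qed
  \<comment> \<open>The 1 in each exponent splits off one factor of every variable.\<close>
  have "(\<Prod>w\<in>verts G. Var w ^ F v w) = (\<Prod>w\<in>verts G. Var w) * (\<Prod>w\<in>verts G. Var w ^ A' v w)"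
    for v by (simp add: F_def prod.distrib)
  then have "avalanche_poly ?E
      = (\<Prod>w\<in>verts G. Var w) * (\<Sum>v\<in>verts G. \<Prod>w\<in>verts G. Var w ^ A' v w)"
    by (simp add: F.avalanche_poly_eq nonsink sum_distrib_left)
  \<comment> \<open>The summand 1 belongs to the grain dropped at the old sink, whose exponents in
    \<open>A'\<close> are all zero.\<close>
  also have "(\<Sum>v\<in>verts G. \<Prod>w\<in>verts G. Var w ^ A' v w)
      = 1 + (\<Sum>v\<in>nonsink G. \<Prod>w\<in>verts G. Var w ^ A' v w)"
    by (simp add: A.sum_verts A'_def)
  also have "(\<Sum>v\<in>nonsink G. \<Prod>w\<in>verts G. Var w ^ A' v w) = avalanche_poly G"
    unfolding A.avalanche_poly_eq
  proof (rule sum.cong)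
    fix v assume v: "v \<in> nonsink G"
    then show "(\<Prod>w\<in>verts G. Var w ^ A' v w) = (\<Prod>w\<in>nonsink G. Var w ^ A v w)"
      using A.nonsink_subset A.green_outside[OF v]
      by (intro prod.mono_neutral_cong_right) (auto simp: A'_def)
  qed simp
  finally show ?thesis by (simp add: nonsink add.commute)
qed

theorem theorem18:
  fixes T T\<^sub>1 T\<^sub>2 :: "'v sink_graph" and r s' :: 'v
  shows "(is_tree T\<^sub>1 \<and> is_tree T\<^sub>2 \<and> nonsink T\<^sub>1 \<inter> nonsink T\<^sub>2 = {} \<and>
            r \<notin> nonsink T\<^sub>1 \<union> nonsink T\<^sub>2 \<longrightarrow>
            avalanche_poly (tree_add r T\<^sub>1 T\<^sub>2) = avalanche_poly T\<^sub>1 + avalanche_poly T\<^sub>2)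
       \<and> (is_tree T \<and> s' \<notin> verts T \<longrightarrow>
            avalanche_poly (root_extension s' T) =
              (\<Prod>v \<in> nonsink (root_extension s' T). Var v) * (avalanche_poly T + 1))"
  using avalanche_poly_tree_add[of T\<^sub>1 T\<^sub>2 r] avalanche_poly_root_extension[of T s'] by blast

end
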